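(* Let $m_1,m_2,m_3>0$ and let a shape on a meridian be given by angle differences $\theta_{ij}=\theta_i-\theta_j$ ($i,j\in\{1,2,3\}$), with $\theta_{ij}\notin\pi\mathbb{Z}$ for $i\neq j$. Suppose $A\neq0$. Then $$\det\begin{pmatrix} G_{12}-G_{23} & G_{31}-G_{12} \\ {} F_{12}-F_{23} & F_{31}-F_{12} \end{pmatrix}=0$$ is a necessary and sufficient condition for the shape to satisfy the equations of motion $$s\,\frac{\omega^2}{2A}(G_{ij}-G_{jk})=F_{ij}-F_{jk}\quad\text{for }(i,j,k)\in\{(1,2,3),(2,3,1),(3,1,2)\}$$ for some $s\in\{1,-1\}$ and some $\omega\ge0$, and then to generate an Euler relative equilibrium on a rotating meridian (with angles $\theta_i$ determined by the shape and $s$ through the translation formula given in the context, and angular velocity $\omega$; a fixed point if $\omega=0$).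
   Context: Three point particles with masses $m_k>0$ move on the unit sphere $\mathbb{S}^2\subset\mathbb{R}^3$ at positions $q_k$, with $\cos\sigma_{ij}=q_i\cdot q_j$, $\sigma_{ij}\in(0,\pi)$. The motion is governed by the Euler–Lagrange equations on $(\mathbb{S}^2)^3$ of $L=\sum_k\frac{m_k}{2}|\dot q_k|^2+\sum_{i<j}m_im_jU(q_i\cdot q_j)$, where $U:(-1,1)\to\mathbb{R}$ is differentiable with derivative $U'$ (with respect to its argument) continuous, nowhere zero, of constant sign. A relative equilibrium is a solution with $\dot q_k=\Omega\times q_k$ for all $k$, $\Omega\in\mathbb{R}^3$ constant; it is a fixed point if $\dot q_k=0$. An Euler relative equilibrium is one with all three bodies on a common great circle. It is on a rotating meridian if, with $\Omega=\omega e_z$, the bodies are at $q_k=(\sin\theta_k\cos\phi,\sin\theta_k\sin\phi,\cos\theta_k)^T$ with a common $\phi=\omega t+\text{const}$ and constant $\theta_k\in[-\pi,\pi]$ (extended range; angles are taken modulo $2\pi$). Notation: $F_{ij}=m_im_j\sin(\theta_i-\theta_j)\,U'(\cos\theta_{ij})$, $G_{ij}=m_im_j\sin(2(\theta_i-\theta_j))$, $A=\sqrt{D}$, $D=\sum_\ell m_\ell^2+2\sum_{i<j}m_im_j\cos(2\theta_{ij})$. Translation formula: $(\cos2\theta_i,\sin2\theta_i)=sA^{-1}\sum_{j=1}^3m_j(\cos2\theta_{ij},\sin2\theta_{ij})$ for $i=1,2,3$, which says that the $z$-axis is a principal axis of the inertia tensor (equivalently $\sum_k m_k\sin2\theta_k=0$).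 *)

theory Defs
  imports "HOL-Analysis.Analysis" "HOL-Library.Real_Mod"
begin

text \<open>
  The three bodies are indexed by the type \<^typ>\<open>3\<close> (with elements 1, 2 and 3 = 0), so that a
  configuration, and likewise a velocity, is an element of \<^typ>\<open>real^3^3\<close>: \<open>Q $ k\<close> is the
  position of body \<open>k\<close>. Sums over unordered pairs are written out over the explicit set
  \<open>{(1,2), (1,3), (2,3)}\<close>.
\<close>

definition lagrangian ::
    "(3 \<Rightarrow> real) \<Rightarrow> (real \<Rightarrow> real) \<Rightarrow> real^3^3 \<Rightarrow> real^3^3 \<Rightarrow> real" where
  "lagrangian m U Q V =
     (\<Sum>k\<in>UNIV. m k / 2 * (norm (V $ k))\<^sup>2) +
     (\<Sum>(i, j)\<in>{(1, 2), (1, 3), (2, 3)}. m i * m j * U (Q $ i \<bullet> Q $ j))"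

text \<open>
  Euler--Lagrange equations on the product of spheres for a Lagrangian that is given on the
  ambient space: \<open>d/dt (\<partial>L/\<partial>V) - \<partial>L/\<partial>Q\<close> annihilates every vector tangent to the product
  of spheres at \<open>Q t\<close>.
\<close>

definition euler_lagrange_on_spheres ::
    "(real^3^3 \<Rightarrow> real^3^3 \<Rightarrow> real) \<Rightarrow> (real \<Rightarrow> real^3^3) \<Rightarrow> bool" where
  "euler_lagrange_on_spheres L Q \<longleftrightarrow>
     (\<forall>t k. norm (Q t $ k) = 1) \<and>
     (\<exists>Q' P P' D. \<forall>t.
        (Q has_vector_derivative Q' t) (at t) \<and>
        GDERIV (\<lambda>V. L (Q t) V) (Q' t) :> P t \<and>
        (P has_vector_derivative P' t) (at t) \<and>
        GDERIV (\<lambda>X. L X (Q' t)) (Q t) :> D t \<and>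
        (\<forall>V. (\<forall>k. V $ k \<bullet> Q t $ k = 0) \<longrightarrow> (P' t - D t) \<bullet> V = 0))"

text \<open>
  The potential is only meaningful on the open interval \<open>(-1, 1)\<close>, so a solution has to avoid
  collisions and antipodal pairs.
\<close>

definition three_body_solution ::
    "(3 \<Rightarrow> real) \<Rightarrow> (real \<Rightarrow> real) \<Rightarrow> (real \<Rightarrow> real^3^3) \<Rightarrow> bool" where
  "three_body_solution m U Q \<longleftrightarrow>
     (\<forall>t i j. i \<noteq> j \<longrightarrow> Q t $ i \<bullet> Q t $ j \<in> {-1<..<1}) \<and>
     euler_lagrange_on_spheres (lagrangian m U) Q"

definition relative_equilibrium ::
    "(3 \<Rightarrow> real) \<Rightarrow> (real \<Rightarrow> real) \<Rightarrow> real^3 \<Rightarrow> (real \<Rightarrow> real^3^3) \<Rightarrow> bool" where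
  "relative_equilibrium m U \<Omega> Q \<longleftrightarrow>
     three_body_solution m U Q \<and>
     (\<forall>t k. ((\<lambda>t. Q t $ k) has_vector_derivative cross3 \<Omega> (Q t $ k)) (at t))"

definition fixed_point ::
    "(3 \<Rightarrow> real) \<Rightarrow> (real \<Rightarrow> real) \<Rightarrow> (real \<Rightarrow> real^3^3) \<Rightarrow> bool" where
  "fixed_point m U Q \<longleftrightarrow>
     (\<exists>\<Omega>. relative_equilibrium m U \<Omega> Q) \<and>
     (\<forall>t k. ((\<lambda>t. Q t $ k) has_vector_derivative 0) (at t))"

definition on_common_great_circle :: "(real \<Rightarrow> real^3^3) \<Rightarrow> bool" where
  "on_common_great_circle Q \<longleftrightarrow> (\<forall>t. \<exists>n. n \<noteq> 0 \<and> (\<forall>k. n \<bullet> Q t $ k = 0))"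

definition euler_relative_equilibrium ::
    "(3 \<Rightarrow> real) \<Rightarrow> (real \<Rightarrow> real) \<Rightarrow> real^3 \<Rightarrow> (real \<Rightarrow> real^3^3) \<Rightarrow> bool" where
  "euler_relative_equilibrium m U \<Omega> Q \<longleftrightarrow>
     relative_equilibrium m U \<Omega> Q \<and> on_common_great_circle Q"

definition meridian_motion ::
    "(3 \<Rightarrow> real) \<Rightarrow> real \<Rightarrow> real \<Rightarrow> real \<Rightarrow> real^3^3" where
  "meridian_motion \<theta> \<omega> \<phi>\<^sub>0 t =
     (\<chi> k. vector [sin (\<theta> k) * cos (\<omega> * t + \<phi>\<^sub>0), sin (\<theta> k) * sin (\<omega> * t + \<phi>\<^sub>0), cos (\<theta> k)])"

definition euler_equilibrium_on_rotating_meridian ::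
    "(3 \<Rightarrow> real) \<Rightarrow> (real \<Rightarrow> real) \<Rightarrow> (3 \<Rightarrow> real) \<Rightarrow> real \<Rightarrow> (real \<Rightarrow> real^3^3) \<Rightarrow> bool" where
  "euler_equilibrium_on_rotating_meridian m U \<theta> \<omega> Q \<longleftrightarrow>
     euler_relative_equilibrium m U (\<omega> *\<^sub>R axis 3 1) Q \<and>
     (\<forall>k. \<theta> k \<in> {-pi..pi}) \<and> (\<exists>\<phi>\<^sub>0. Q = meridian_motion \<theta> \<omega> \<phi>\<^sub>0)"

text \<open>Below, \<open>\<delta> i j\<close> is the angle difference of the bodies \<open>i\<close> and \<open>j\<close>.\<close>

definition shape_F :: "(3 \<Rightarrow> real) \<Rightarrow> (real \<Rightarrow> real) \<Rightarrow> (3 \<Rightarrow> 3 \<Rightarrow> real) \<Rightarrow> 3 \<Rightarrow> 3 \<Rightarrow> real" where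
  "shape_F m U' \<delta> i j = m i * m j * sin (\<delta> i j) * U' (cos (\<delta> i j))"

definition shape_G :: "(3 \<Rightarrow> real) \<Rightarrow> (3 \<Rightarrow> 3 \<Rightarrow> real) \<Rightarrow> 3 \<Rightarrow> 3 \<Rightarrow> real" where
  "shape_G m \<delta> i j = m i * m j * sin (2 * \<delta> i j)"

definition shape_A :: "(3 \<Rightarrow> real) \<Rightarrow> (3 \<Rightarrow> 3 \<Rightarrow> real) \<Rightarrow> real" where
  "shape_A m \<delta> = sqrt ((\<Sum>l\<in>UNIV. (m l)\<^sup>2) +
     2 * (\<Sum>(i, j)\<in>{(1, 2), (1, 3), (2, 3)}. m i * m j * cos (2 * \<delta> i j)))"

definition shape_equations ::
    "(3 \<Rightarrow> real) \<Rightarrow> (real \<Rightarrow> real) \<Rightarrow> (3 \<Rightarrow> 3 \<Rightarrow> real) \<Rightarrow> real \<Rightarrow> real \<Rightarrow> bool" where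
  "shape_equations m U' \<delta> s \<omega> \<longleftrightarrow>
     (\<forall>(i, j, k)\<in>{(1, 2, 3), (2, 3, 1), (3, 1, 2)}.
        s * (\<omega>\<^sup>2 / (2 * shape_A m \<delta>)) * (shape_G m \<delta> i j - shape_G m \<delta> j k) =
          shape_F m U' \<delta> i j - shape_F m U' \<delta> j k)"

text \<open>
  The angles \<open>\<theta> k\<close> realise the shape \<open>\<delta>\<close> (modulo \<open>2\<pi>\<close>) and satisfy the translation formula
  with sign \<open>s\<close>. These conditions determine \<open>\<theta>\<close> modulo \<open>2\<pi>\<close> up to a common shift by \<open>\<pi>\<close>,
  that is, up to replacing the configuration by its antipode.
\<close>

definition translated_angles ::
    "(3 \<Rightarrow> real) \<Rightarrow> (3 \<Rightarrow> 3 \<Rightarrow> real) \<Rightarrow> real \<Rightarrow> (3 \<Rightarrow> real) \<Rightarrow> bool" where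
  "translated_angles m \<delta> s \<theta> \<longleftrightarrow>
     (\<forall>k. \<theta> k \<in> {-pi..pi}) \<and>
     (\<forall>i j. [\<theta> i - \<theta> j = \<delta> i j] (rmod (2 * pi))) \<and>
     (\<forall>i. cos (2 * \<theta> i) = s / shape_A m \<delta> * (\<Sum>j\<in>UNIV. m j * cos (2 * \<delta> i j)) \<and>
          sin (2 * \<theta> i) = s / shape_A m \<delta> * (\<Sum>j\<in>UNIV. m j * sin (2 * \<delta> i j)))"

definition generates_euler_equilibrium ::
    "(3 \<Rightarrow> real) \<Rightarrow> (real \<Rightarrow> real) \<Rightarrow> (3 \<Rightarrow> 3 \<Rightarrow> real) \<Rightarrow> real \<Rightarrow> real \<Rightarrow> bool" where
  "generates_euler_equilibrium m U \<delta> s \<omega> \<longleftrightarrow>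
     (\<exists>\<theta>. translated_angles m \<delta> s \<theta>) \<and>
     (\<forall>\<theta> \<phi>\<^sub>0. translated_angles m \<delta> s \<theta> \<longrightarrow>
        euler_equilibrium_on_rotating_meridian m U \<theta> \<omega> (meridian_motion \<theta> \<omega> \<phi>\<^sub>0) \<and>
        (\<omega> = 0 \<longrightarrow> fixed_point m U (meridian_motion \<theta> \<omega> \<phi>\<^sub>0)))"

end

theory Submission
  imports Defs
begin

text \<open>
  For a motion with \<open>q\<^sub>k' = \<Omega> \<times> q\<^sub>k\<close> the Euler--Lagrange equations say that
  \<open>m\<^sub>k \<Omega> \<times> (\<Omega> \<times> q\<^sub>k)\<close> minus the force on body \<open>k\<close> is normal to the sphere. On a rotating meridian
  this vector lies in the plane of the meridian, so only its component along the meridian matters: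
  \<open>\<omega>\<^sup>2/2 m\<^sub>k sin 2\<theta>\<^sub>k = \<Sum>\<^sub>j F\<^sub>k\<^sub>j\<close>. The translation formula turns the left-hand side into
  \<open>s \<omega>\<^sup>2/(2A) \<Sum>\<^sub>j G\<^sub>k\<^sub>j\<close>, which gives the equations for the shape. Two of them are independent; they say
  that the second row of the matrix is \<open>s \<omega>\<^sup>2/(2A)\<close> times the first, and this factor takes every real
  value. So the determinant criterion needs only that the first row is not zero. With
  \<open>z = \<Sum>\<^sub>j m\<^sub>j exp(2i\<alpha>\<^sub>j)\<close> we have \<open>A = |z|\<close>, and if the first row is zero then every \<open>exp(2i\<alpha>\<^sub>k)\<close> is parallel
  to \<open>z \<noteq> 0\<close>; hence all differences are odd multiples of \<open>\<pi>/2\<close>, which is impossible for three bodies.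
\<close>

section \<open>Derivatives of vectors and gradients, component by component\<close>

lemmas has_derivative_vec_nth [derivative_intros] =
  bounded_linear.has_derivative[OF bounded_linear_vec_nth]

lemma has_derivative_vecI:
  fixes f :: "'a::real_normed_vector \<Rightarrow> 'b::euclidean_space ^ 'n"
  assumes "\<And>k. ((\<lambda>x. f x $ k) has_derivative (\<lambda>h. f' h $ k)) (at x)"
  shows "(f has_derivative f') (at x)"
  unfolding has_derivative_componentwise_within[of f]
proof
  fix b :: "'b ^ 'n" assume "b \<in> Basis"
  then obtain i u where b: "b = axis i u"
    by (auto simp: Basis_vec_def)
  show "((\<lambda>x. f x \<bullet> b) has_derivative (\<lambda>x. f' x \<bullet> b)) (at x)"
    unfolding b inner_axis by (intro has_derivative_inner_left assms)
qed

lemma has_vector_derivative_vec_iff: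
  fixes f :: "real \<Rightarrow> 'b::euclidean_space ^ 'n"
  shows "(f has_vector_derivative f') (at t) \<longleftrightarrow>
    (\<forall>k. ((\<lambda>t. f t $ k) has_vector_derivative f' $ k) (at t))"
  unfolding has_vector_derivative_def
  by (auto intro!: has_derivative_vecI dest: has_derivative_vec_nth)

text \<open>The inner product is nondegenerate: testing with \<open>D - E\<close> suffices. This
  pins down the gradients that \<open>euler_lagrange_on_spheres\<close> quantifies
  existentially.\<close>

lemma GDERIV_unique:
  assumes "GDERIV f x :> D" "GDERIV f x :> E"
  shows "D = E"
proof -
  have "(\<lambda>h. h \<bullet> D) = (\<lambda>h. h \<bullet> E)"
    using assms unfolding gderiv_def by (rule has_derivative_unique)
  then have "(D - E) \<bullet> (D - E) = 0"
    by (simp add: inner_diff_right fun_eq_iff)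
  then show ?thesis by simp
qed

section \<open>Gradients of the Lagrangian\<close>

text \<open>The ambient gradient of the potential term in the position of body \<open>k\<close>. Its
  part normal to the sphere is kept, since it vanishes against tangent test vectors.\<close>

definition force :: "(3 \<Rightarrow> real) \<Rightarrow> (real \<Rightarrow> real) \<Rightarrow> real^3^3 \<Rightarrow> 3 \<Rightarrow> real^3" where
  "force m U' Q k = (\<Sum>j\<in>UNIV - {k}. (m k * m j * U' (Q $ k \<bullet> Q $ j)) *\<^sub>R Q $ j)"

lemma GDERIV_lagrangian_velocity:
  "GDERIV (\<lambda>V. lagrangian m U Q V) V :> (\<chi> k. m k *\<^sub>R V $ k)"
  unfolding lagrangian_def gderiv_def power2_norm_eq_inner
  by (auto intro!: derivative_eq_intros sum.cong
      simp: inner_vec_def[where 'b="3" and 'a="real^3"] fun_eq_iff inner_commute)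

lemma sum_pairs_3:
  "(\<Sum>(i, j)\<in>{(1, 2), (1, 3), (2, 3)}. f i j) = f 1 2 + (f 1 3 + f 2 3)"
  for f :: "3 \<Rightarrow> 3 \<Rightarrow> 'a::comm_monoid_add"
  by simp

lemma sum_others_3:
  "(\<Sum>j\<in>UNIV - {1}. f j) = f 2 + f 3"
  "(\<Sum>j\<in>UNIV - {2}. f j) = f 1 + f 3"
  "(\<Sum>j\<in>UNIV - {3}. f j) = f 1 + f 2"
  for f :: "3 \<Rightarrow> 'a::ab_group_add"
  by (simp_all only: sum_diff1 finite UNIV_I if_True sum_3) simp_all

text \<open>Chain rule for each of the three pairs, then regrouping by body: each body occurs in two
  pairs. Differentiability of \<open>U\<close> is asked only at the inner products that
  occur.\<close>

lemma GDERIV_lagrangian_position: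
  assumes "\<And>i j. i \<noteq> j \<Longrightarrow> (U has_real_derivative U' (Q $ i \<bullet> Q $ j)) (at (Q $ i \<bullet> Q $ j))"
  shows "GDERIV (\<lambda>X. lagrangian m U X V) Q :> (\<chi> k. force m U' Q k)"
proof -
  have U: "((\<lambda>X. U (X $ i \<bullet> X $ j)) has_derivative
      (\<lambda>h. (h $ j \<bullet> Q $ i + h $ i \<bullet> Q $ j) * U' (Q $ i \<bullet> Q $ j))) (at Q)" if "i \<noteq> j" for i j
  proof -
    have "((\<lambda>X. X $ i \<bullet> X $ j) has_derivative (\<lambda>h. Q $ i \<bullet> h $ j + h $ i \<bullet> Q $ j)) (at Q)"
      by (intro has_derivative_inner bounded_linear_imp_has_derivative bounded_linear_vec_nth)
    from DERIV_compose_FDERIV[OF assms[OF that] this] show ?thesis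
      by (simp only: inner_commute[of "Q $ i" "h $ j" for h])
  qed
  have distinct: "1 \<noteq> (2::3)" "1 \<noteq> (3::3)" "2 \<noteq> (3::3)"
    by simp_all
  let ?K = "\<Sum>k\<in>UNIV. m k / 2 * (norm (V $ k))\<^sup>2"
  let ?D = "\<lambda>(i::3) (j::3) (h::real^3^3). (h $ j \<bullet> Q $ i + h $ i \<bullet> Q $ j) * U' (Q $ i \<bullet> Q $ j)"
  have "(\<lambda>X. lagrangian m U X V) = (\<lambda>X. ?K + (m 1 * m 2 * U (X $ 1 \<bullet> X $ 2) +
      (m 1 * m 3 * U (X $ 1 \<bullet> X $ 3) + m 2 * m 3 * U (X $ 2 \<bullet> X $ 3))))"
    unfolding lagrangian_def sum_pairs_3 ..
  moreover have "(\<dots> has_derivative (\<lambda>h. 0 + (m 1 * m 2 * ?D 1 2 h +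
      (m 1 * m 3 * ?D 1 3 h + m 2 * m 3 * ?D 2 3 h)))) (at Q)"
    by (rule has_derivative_add[OF has_derivative_const has_derivative_add[OF
        has_derivative_mult_right[OF U[OF distinct(1)]] has_derivative_add[OF
        has_derivative_mult_right[OF U[OF distinct(2)]]
        has_derivative_mult_right[OF U[OF distinct(3)]]]]])
  moreover have "h \<bullet> (\<chi> k. force m U' Q k) = 0 + (m 1 * m 2 * ?D 1 2 h +
      (m 1 * m 3 * ?D 1 3 h + m 2 * m 3 * ?D 2 3 h))" for h :: "real^3^3"
    \<comment> \<open>\<open>force\<close> meets each pair in both orders;
      \<open>inner_commute\<close> brings the arguments of \<open>U'\<close> to the order used in
      the Lagrangian.\<close>
    unfolding inner_vec_def[where 'b="3" and 'a="real^3"] sum_3 vec_lambda_beta force_def sum_others_3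
      inner_add_right inner_scaleR_right inner_commute[of "Q $ 2" "Q $ 1"]
      inner_commute[of "Q $ 3" "Q $ 1"] inner_commute[of "Q $ 3" "Q $ 2"]
    by (simp only: algebra_simps add_0)
  ultimately show ?thesis
    by (simp only: gderiv_def)
qed

section \<open>Euler-Lagrange equations along a rotation\<close>

text \<open>Test vectors \<open>axis k v\<close>, which move one body only, decouple the condition
  into one for each body.\<close>

lemma orthogonal_vec_iff:
  fixes X Q :: "'a::real_inner ^ 'n"
  shows "(\<forall>V. (\<forall>k. V $ k \<bullet> Q $ k = 0) \<longrightarrow> X \<bullet> V = 0) \<longleftrightarrow>
    (\<forall>k v. v \<bullet> Q $ k = 0 \<longrightarrow> X $ k \<bullet> v = 0)"
proof safe
  fix k v
  assume *: "\<forall>V. (\<forall>k. V $ k \<bullet> Q $ k = 0) \<longrightarrow> X \<bullet> V = 0" and "v \<bullet> Q $ k = 0"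
  then have "X \<bullet> axis k v = 0" by (auto simp: axis_def)
  then show "X $ k \<bullet> v = 0" by (simp add: inner_axis)
qed (simp add: inner_vec_def)

lemma has_vector_derivative_cross_right:
  "(f has_vector_derivative f') (at t) \<Longrightarrow>
    ((\<lambda>t. cross3 a (f t)) has_vector_derivative cross3 a f') (at t)"
  using bilinear_cross unfolding bilinear_def linear_conv_bounded_linear
  by (blast intro: bounded_linear.has_vector_derivative)

text \<open>The rotation prescribes the velocity, hence the momenta, their derivatives and the
  gradients; uniqueness of derivatives forces every witness in
  \<open>euler_lagrange_on_spheres\<close>, and only the tangential condition remains.\<close>

lemma euler_lagrange_rotation_iff:
  assumes unit: "\<And>t k. norm (Q t $ k) = 1"
    and U_deriv: "\<And>t i j. i \<noteq> j \<Longrightarrow>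
      (U has_real_derivative U' (Q t $ i \<bullet> Q t $ j)) (at (Q t $ i \<bullet> Q t $ j))"
    and rot: "\<And>t k. ((\<lambda>t. Q t $ k) has_vector_derivative cross3 \<Omega> (Q t $ k)) (at t)"
  shows "euler_lagrange_on_spheres (lagrangian m U) Q \<longleftrightarrow>
    (\<forall>t k v. v \<bullet> Q t $ k = 0 \<longrightarrow>
      (m k *\<^sub>R cross3 \<Omega> (cross3 \<Omega> (Q t $ k)) - force m U' (Q t) k) \<bullet> v = 0)"
proof -
  define Q\<^sub>1 P\<^sub>0 P\<^sub>1 D\<^sub>0 :: "real \<Rightarrow> real^3^3" where
    "Q\<^sub>1 = (\<lambda>t. \<chi> k. cross3 \<Omega> (Q t $ k))" and
    "P\<^sub>0 = (\<lambda>t. \<chi> k. m k *\<^sub>R Q\<^sub>1 t $ k)" and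
    "P\<^sub>1 = (\<lambda>t. \<chi> k. m k *\<^sub>R cross3 \<Omega> (cross3 \<Omega> (Q t $ k)))" and
    "D\<^sub>0 = (\<lambda>t. \<chi> k. force m U' (Q t) k)"
  have Q1: "(Q has_vector_derivative Q\<^sub>1 t) (at t)" for t
    unfolding has_vector_derivative_vec_iff[of Q] by (simp add: Q\<^sub>1_def rot)
  have P0: "GDERIV (\<lambda>V. lagrangian m U (Q t) V) (Q\<^sub>1 t) :> P\<^sub>0 t" for t
    unfolding P\<^sub>0_def by (rule GDERIV_lagrangian_velocity)
  have P1: "(P\<^sub>0 has_vector_derivative P\<^sub>1 t) (at t)" for t
    unfolding has_vector_derivative_vec_iff[of P\<^sub>0]
    unfolding P\<^sub>0_def P\<^sub>1_def Q\<^sub>1_def vec_lambda_beta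
    by (intro allI bounded_linear.has_vector_derivative[OF bounded_linear_scaleR_right]
        has_vector_derivative_cross_right rot)
  have D0: "GDERIV (\<lambda>X. lagrangian m U X (Q\<^sub>1 t)) (Q t) :> D\<^sub>0 t" for t
    unfolding D\<^sub>0_def using U_deriv by (intro GDERIV_lagrangian_position)
  have "euler_lagrange_on_spheres (lagrangian m U) Q \<longleftrightarrow>
    (\<forall>t V. (\<forall>k. V $ k \<bullet> Q t $ k = 0) \<longrightarrow> (P\<^sub>1 t - D\<^sub>0 t) \<bullet> V = 0)"
  proof
    assume "euler_lagrange_on_spheres (lagrangian m U) Q"
    then obtain Q' P P' D where *: "\<And>t. (Q has_vector_derivative Q' t) (at t)"
      "\<And>t. GDERIV (\<lambda>V. lagrangian m U (Q t) V) (Q' t) :> P t"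
      "\<And>t. (P has_vector_derivative P' t) (at t)"
      "\<And>t. GDERIV (\<lambda>X. lagrangian m U X (Q' t)) (Q t) :> D t"
      "\<And>t V. (\<forall>k. V $ k \<bullet> Q t $ k = 0) \<Longrightarrow> (P' t - D t) \<bullet> V = 0"
      unfolding euler_lagrange_on_spheres_def by blast
    \<comment> \<open>The velocity comes first because both gradients depend on it, and
      \<open>P\<close> has to be known before \<open>P'\<close>.\<close>
    have "Q' = Q\<^sub>1"
      using vector_derivative_unique_at[OF *(1) Q1] by blast
    moreover have "P = P\<^sub>0"
      using GDERIV_unique[OF *(2)[unfolded \<open>Q' = Q\<^sub>1\<close>] P0] by blast
    moreover have "P' = P\<^sub>1"
      using vector_derivative_unique_at[OF *(3)[unfolded \<open>P = P\<^sub>0\<close>] P1] by blast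
    moreover have "D = D\<^sub>0"
      using GDERIV_unique[OF *(4)[unfolded \<open>Q' = Q\<^sub>1\<close>] D0] by blast
    ultimately show "\<forall>t V. (\<forall>k. V $ k \<bullet> Q t $ k = 0) \<longrightarrow> (P\<^sub>1 t - D\<^sub>0 t) \<bullet> V = 0"
      using *(5) by blast
  next
    assume "\<forall>t V. (\<forall>k. V $ k \<bullet> Q t $ k = 0) \<longrightarrow> (P\<^sub>1 t - D\<^sub>0 t) \<bullet> V = 0"
    then show "euler_lagrange_on_spheres (lagrangian m U) Q"
      unfolding euler_lagrange_on_spheres_def using unit Q1 P0 P1 D0 by blast
  qed
  then show ?thesis
    by (simp add: orthogonal_vec_iff P\<^sub>1_def D\<^sub>0_def)
qed

section \<open>Geometry of a meridian\<close>

definition meridian_point :: "real \<Rightarrow> real \<Rightarrow> real^3" where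
  "meridian_point \<phi> x = vector [sin x * cos \<phi>, sin x * sin \<phi>, cos x]"

lemma meridian_motion_nth:
  "meridian_motion \<theta> \<omega> \<phi>\<^sub>0 t $ k = meridian_point (\<omega> * t + \<phi>\<^sub>0) (\<theta> k)"
  by (simp add: meridian_motion_def meridian_point_def)

lemma inner_meridian_point:
  "meridian_point \<phi> x \<bullet> meridian_point \<phi> y = cos (x - y)"
proof -
  have "meridian_point \<phi> x \<bullet> meridian_point \<phi> y =
      sin x * sin y * ((sin \<phi>)\<^sup>2 + (cos \<phi>)\<^sup>2) + cos x * cos y"
    unfolding meridian_point_def inner_vec_def sum_3 vector_3 inner_real_def by algebra
  then show ?thesis
    by (simp add: cos_diff)
qed

lemma norm_meridian_point: "norm (meridian_point \<phi> x) = 1"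
  by (simp add: norm_eq_sqrt_inner inner_meridian_point)

text \<open>The points at angles \<open>x\<close> and \<open>x + pi / 2\<close> form an orthonormal
  basis of the plane of the meridian; the second is the unit tangent at the first. The coordinates
  come from the addition formulas.\<close>

lemma meridian_point_decompose:
  "meridian_point \<phi> y =
     cos (y - x) *\<^sub>R meridian_point \<phi> x + sin (y - x) *\<^sub>R meridian_point \<phi> (x + pi / 2)"
proof -
  have "sin y = cos (y - x) * sin x + sin (y - x) * cos x"
    using sin_add[of "y - x" x] by simp
  moreover have "cos y = cos (y - x) * cos x - sin (y - x) * sin x"
    using cos_add[of "y - x" x] by simp
  ultimately show ?thesis
    by (simp only: meridian_point_def vec_eq_iff forall_3 vector_3 vector_add_component
        vector_scaleR_component sin_add cos_add cos_pi_half sin_pi_half) (simp add: algebra_simps)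
qed

lemma cross_axis_meridian_point:
  "cross3 (\<omega> *\<^sub>R axis 3 1) (meridian_point \<phi> x) =
     (\<omega> * sin x) *\<^sub>R vector [- sin \<phi>, cos \<phi>, 0]"
  by (simp add: cross3_simps meridian_point_def axis_def forall_3)

text \<open>This is the centripetal acceleration. The point at angle \<open>pi / 2\<close> is the
  horizontal unit vector in the plane of the meridian, so the acceleration lies in that plane
  again.\<close>

lemma cross_axis_cross_axis_meridian_point:
  "cross3 (\<omega> *\<^sub>R axis 3 1) (cross3 (\<omega> *\<^sub>R axis 3 1) (meridian_point \<phi> x)) =
     - (\<omega>\<^sup>2 * sin x) *\<^sub>R meridian_point \<phi> (pi / 2)"
  unfolding cross_axis_meridian_point
  by (simp add: cross3_simps meridian_point_def axis_def forall_3 power2_eq_square)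

lemma meridian_motion_has_vector_derivative:
  "((\<lambda>t. meridian_motion \<theta> \<omega> \<phi>\<^sub>0 t $ k) has_vector_derivative
      cross3 (\<omega> *\<^sub>R axis 3 1) (meridian_motion \<theta> \<omega> \<phi>\<^sub>0 t $ k)) (at t)"
  unfolding has_vector_derivative_vec_iff meridian_motion_nth cross_axis_meridian_point
  unfolding meridian_point_def
  by (auto simp: forall_3 vector_3 has_real_derivative_iff_has_vector_derivative[symmetric]
      intro!: derivative_eq_intros)


section \<open>Equations of motion on a rotating meridian\<close>

lemma sin_nonzero_imp_cos_in_interval:
  fixes x :: real
  assumes "sin x \<noteq> 0"
  shows "cos x \<in> {-1<..<1}"
proof -
  have "(cos x)\<^sup>2 < 1"
    using assms by (simp add: cos_squared_eq)
  then show ?thesis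
    by (simp add: abs_square_less_1 abs_less_iff)
qed

text \<open>Acceleration and force both lie in the plane of the meridian, so a tangent test vector
  enters only through its inner product with the unit tangent \<open>?e t k\<close>. One scalar
  equation per body is left, the same at all times.\<close>

lemma meridian_motion_solution_iff:
  assumes U_deriv: "\<And>x. x \<in> {-1<..<1} \<Longrightarrow> (U has_real_derivative U' x) (at x)"
    and sin_nz: "\<And>i j. i \<noteq> j \<Longrightarrow> sin (\<theta> i - \<theta> j) \<noteq> 0"
  shows "three_body_solution m U (meridian_motion \<theta> \<omega> \<phi>\<^sub>0) \<longleftrightarrow>
    (\<forall>k. \<omega>\<^sup>2 / 2 * (m k * sin (2 * \<theta> k)) =
      (\<Sum>j\<in>UNIV - {k}. shape_F m U' (\<lambda>i j. \<theta> i - \<theta> j) k j))"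
    (is "_ \<longleftrightarrow> (\<forall>k. ?l k = ?r k)")
proof -
  let ?Q = "meridian_motion \<theta> \<omega> \<phi>\<^sub>0" and ?\<Omega> = "\<omega> *\<^sub>R axis 3 1 :: real^3"
  let ?e = "\<lambda>t k. meridian_point (\<omega> * t + \<phi>\<^sub>0) (\<theta> k + pi / 2)"
  have inner: "?Q t $ i \<bullet> ?Q t $ j = cos (\<theta> i - \<theta> j)" for t i j
    by (simp add: meridian_motion_nth inner_meridian_point)
  have no_collision: "?Q t $ i \<bullet> ?Q t $ j \<in> {-1<..<1}" if "i \<noteq> j" for t i j
    unfolding inner by (intro sin_nonzero_imp_cos_in_interval sin_nz that)
  have tangential: "(m k *\<^sub>R cross3 ?\<Omega> (cross3 ?\<Omega> (?Q t $ k)) - force m U' (?Q t) k) \<bullet> v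
      = (?r k - ?l k) * (?e t k \<bullet> v)" if v: "v \<bullet> ?Q t $ k = 0" for t k v
  proof -
    \<comment> \<open>In the basis at \<open>\<theta> k\<close>, the component along the position of
      body \<open>k\<close> drops out against \<open>v\<close>.\<close>
    have point: "meridian_point (\<omega> * t + \<phi>\<^sub>0) y \<bullet> v = sin (y - \<theta> k) * (?e t k \<bullet> v)" for y
      using v by (subst meridian_point_decompose[of _ y "\<theta> k"])
        (simp add: meridian_motion_nth inner_add_left inner_commute[of v])
    have "force m U' (?Q t) k \<bullet> v = - ?r k * (?e t k \<bullet> v)"
      unfolding force_def inner inner_sum_left inner_scaleR_left
      unfolding meridian_motion_nth sum_negf[symmetric] sum_distrib_right
    proof (intro sum.cong refl)
      fix j
      have "sin (\<theta> j - \<theta> k) = - sin (\<theta> k - \<theta> j)"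
        by (metis minus_diff_eq sin_minus)
      then show "m k * m j * U' (cos (\<theta> k - \<theta> j)) * (meridian_point (\<omega> * t + \<phi>\<^sub>0) (\<theta> j) \<bullet> v) =
          - shape_F m U' (\<lambda>i j. \<theta> i - \<theta> j) k j * (?e t k \<bullet> v)"
        unfolding point[of "\<theta> j"] by (simp add: shape_F_def)
    qed
    \<comment> \<open>By \<open>point\<close> at \<open>pi / 2\<close> the factor is
      \<open>sin (pi / 2 - \<theta> k)\<close>, that is \<open>cos (\<theta> k)\<close>; this
      produces the double angle.\<close>
    moreover have "cross3 ?\<Omega> (cross3 ?\<Omega> (?Q t $ k)) \<bullet> v
        = - (\<omega>\<^sup>2 * sin (\<theta> k) * cos (\<theta> k)) * (?e t k \<bullet> v)"
      unfolding meridian_motion_nth cross_axis_cross_axis_meridian_point inner_scaleR_left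
        point[of "pi / 2"]
      by (simp add: sin_diff)
    ultimately show ?thesis
      unfolding sin_double by (simp add: inner_diff_left algebra_simps)
  qed
  have "three_body_solution m U ?Q \<longleftrightarrow> (\<forall>t k v. v \<bullet> ?Q t $ k = 0 \<longrightarrow>
      (m k *\<^sub>R cross3 ?\<Omega> (cross3 ?\<Omega> (?Q t $ k)) - force m U' (?Q t) k) \<bullet> v = 0)"
    unfolding three_body_solution_def
    using no_collision euler_lagrange_rotation_iff[of ?Q U U' ?\<Omega> m,
        OF _ U_deriv[OF no_collision] meridian_motion_has_vector_derivative]
    by (simp add: meridian_motion_nth norm_meridian_point)
  also have "\<dots> \<longleftrightarrow> (\<forall>t k v. v \<bullet> ?Q t $ k = 0 \<longrightarrow> (?r k - ?l k) * (?e t k \<bullet> v) = 0)"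
    by (intro iff_allI imp_cong refl) (simp only: tangential)
  also have "\<dots> \<longleftrightarrow> (\<forall>k. ?l k = ?r k)"
  proof (intro iffI allI)
    fix k
    assume "\<forall>t k v. v \<bullet> ?Q t $ k = 0 \<longrightarrow> (?r k - ?l k) * (?e t k \<bullet> v) = 0"
    \<comment> \<open>The unit tangent itself at time 0 serves as test vector.\<close>
    moreover have "?e 0 k \<bullet> ?Q 0 $ k = 0" "?e 0 k \<bullet> ?e 0 k = 1"
      unfolding meridian_motion_nth inner_meridian_point by simp_all
    ultimately have "(?r k - ?l k) * (?e 0 k \<bullet> ?e 0 k) = 0" "?e 0 k \<bullet> ?e 0 k = 1" by blast+
    then show "?l k = ?r k" by (simp only: mult_1_right right_minus_eq)
  qed simp
  finally show ?thesis .
qed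

section \<open>Great circles, relative equilibria and fixed points\<close>

lemma on_common_great_circle_meridian_motion:
  "on_common_great_circle (meridian_motion \<theta> \<omega> \<phi>\<^sub>0)"
  unfolding on_common_great_circle_def
proof
  fix t
  \<comment> \<open>The horizontal unit normal of the plane of the meridian at time
    \<open>t\<close>.\<close>
  let ?n = "vector [- sin (\<omega> * t + \<phi>\<^sub>0), cos (\<omega> * t + \<phi>\<^sub>0), 0] :: real^3"
  have "?n \<noteq> 0"
    using sin_zero_abs_cos_one[of "\<omega> * t + \<phi>\<^sub>0"] by (auto simp: vec_eq_iff forall_3)
  moreover have "\<forall>k. ?n \<bullet> meridian_motion \<theta> \<omega> \<phi>\<^sub>0 t $ k = 0"
    by (simp add: meridian_motion_nth meridian_point_def inner_vec_def sum_3)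
  ultimately show "\<exists>n. n \<noteq> 0 \<and> (\<forall>k. n \<bullet> meridian_motion \<theta> \<omega> \<phi>\<^sub>0 t $ k = 0)"
    by blast
qed

lemma relative_equilibrium_meridian_motion_iff:
  "relative_equilibrium m U (\<omega> *\<^sub>R axis 3 1) (meridian_motion \<theta> \<omega> \<phi>\<^sub>0) \<longleftrightarrow>
    three_body_solution m U (meridian_motion \<theta> \<omega> \<phi>\<^sub>0)"
  by (simp add: relative_equilibrium_def meridian_motion_has_vector_derivative)

lemma fixed_point_meridian_motion:
  assumes "three_body_solution m U (meridian_motion \<theta> 0 \<phi>\<^sub>0)"
  shows "fixed_point m U (meridian_motion \<theta> 0 \<phi>\<^sub>0)"
  using assms relative_equilibrium_meridian_motion_iff[of m U 0 \<theta> \<phi>\<^sub>0]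
    meridian_motion_has_vector_derivative[of \<theta> 0 \<phi>\<^sub>0]
  by (auto simp: fixed_point_def)

lemma euler_equilibrium_meridian_motion_iff:
  assumes "\<And>k. \<theta> k \<in> {-pi..pi}"
  shows "euler_equilibrium_on_rotating_meridian m U \<theta> \<omega> (meridian_motion \<theta> \<omega> \<phi>\<^sub>0) \<longleftrightarrow>
    three_body_solution m U (meridian_motion \<theta> \<omega> \<phi>\<^sub>0)"
  using assms unfolding euler_equilibrium_on_rotating_meridian_def euler_relative_equilibrium_def
  by (auto simp: on_common_great_circle_meridian_motion relative_equilibrium_meridian_motion_iff)

section \<open>From the angles to the shape\<close>

lemma shape_F_minus: "shape_F m U' (\<lambda>i j. \<alpha> i - \<alpha> j) j i = - shape_F m U' (\<lambda>i j. \<alpha> i - \<alpha> j) i j"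
  using sin_minus[of "\<alpha> i - \<alpha> j"] cos_minus[of "\<alpha> i - \<alpha> j"] by (simp add: shape_F_def)

lemma shape_G_minus: "shape_G m (\<lambda>i j. \<alpha> i - \<alpha> j) j i = - shape_G m (\<lambda>i j. \<alpha> i - \<alpha> j) i j"
  using sin_minus[of "2 * (\<alpha> i - \<alpha> j)"] by (simp add: shape_G_def algebra_simps)

text \<open>By antisymmetry of \<open>shape_F\<close> and \<open>shape_G\<close>, the shape equation
  for (i, j, k) is the equation of the middle body j with both sides negated.\<close>

lemma shape_equations_iff:
  "shape_equations m U' (\<lambda>i j. \<alpha> i - \<alpha> j) s \<omega> \<longleftrightarrow>
    (\<forall>k. s * (\<omega>\<^sup>2 / (2 * shape_A m (\<lambda>i j. \<alpha> i - \<alpha> j))) *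
        (\<Sum>j\<in>UNIV - {k}. shape_G m (\<lambda>i j. \<alpha> i - \<alpha> j) k j) =
      (\<Sum>j\<in>UNIV - {k}. shape_F m U' (\<lambda>i j. \<alpha> i - \<alpha> j) k j))"
proof -
  define c where "c = s * (\<omega>\<^sup>2 / (2 * shape_A m (\<lambda>i j. \<alpha> i - \<alpha> j)))"
  have swap: "c * (x - y) = u - v \<longleftrightarrow> c * (y - x) = v - u" for x y u v
    by (auto simp: algebra_simps)
  show ?thesis
    unfolding c_def[symmetric] shape_equations_def
    using shape_F_minus[of m U' \<alpha> 1 2] shape_F_minus[of m U' \<alpha> 2 3] shape_F_minus[of m U' \<alpha> 3 1]
      shape_G_minus[of m \<alpha> 1 2] shape_G_minus[of m \<alpha> 2 3] shape_G_minus[of m \<alpha> 3 1]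
    by (simp add: forall_3 sum_others_3) (use swap in blast)
qed

text \<open>Expansion of the squared modulus of the sum of \<open>m j\<close> times
  exp(2i\<alpha>_j). In particular the argument of the root is nonnegative.\<close>

lemma shape_A_eq:
  "shape_A m (\<lambda>i j. \<alpha> i - \<alpha> j) =
    sqrt ((\<Sum>j\<in>UNIV. m j * cos (2 * \<alpha> j))\<^sup>2 + (\<Sum>j\<in>UNIV. m j * sin (2 * \<alpha> j))\<^sup>2)"
proof -
  have "(m k)\<^sup>2 = (m k * cos (2 * \<alpha> k))\<^sup>2 + (m k * sin (2 * \<alpha> k))\<^sup>2" for k
    by (simp add: power_mult_distrib flip: distrib_left)
  then show ?thesis
    by (simp add: shape_A_def sum_3 right_diff_distrib cos_diff power2_eq_square algebra_simps)
qed

text \<open>With z = C + iS, the number sz/A has modulus 1 and so equals exp(i\<gamma>). The sums in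
  the translation formula are the parts of exp(2i\<alpha>_i) times the conjugate of z, so turning
  the shape back by \<gamma>/2 satisfies it.\<close>

lemma ex_translated_angles:
  assumes A: "shape_A m (\<lambda>i j. \<alpha> i - \<alpha> j) \<noteq> 0" and s: "s \<in> {1, -1}"
  shows "\<exists>\<theta>. translated_angles m (\<lambda>i j. \<alpha> i - \<alpha> j) s \<theta>"
proof -
  define C S where "C = (\<Sum>j\<in>UNIV. m j * cos (2 * \<alpha> j))" and "S = (\<Sum>j\<in>UNIV. m j * sin (2 * \<alpha> j))"
  define A where "A = shape_A m (\<lambda>i j. \<alpha> i - \<alpha> j)"
  have "A \<noteq> 0" "A\<^sup>2 = C\<^sup>2 + S\<^sup>2"
    using A by (simp_all add: A_def shape_A_eq C_def S_def)
  then have "(s * C / A)\<^sup>2 + (s * S / A)\<^sup>2 = 1"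
    using s by (auto simp: power_divide power_mult_distrib simp flip: add_divide_distrib)
  then obtain \<gamma> where \<gamma>: "s * C / A = cos \<gamma>" "s * S / A = sin \<gamma>"
    by (metis sincos_total_2pi)
  \<comment> \<open>Shifting by \<open>pi\<close> before and after the reduction puts the angle into
    the required range around 0.\<close>
  define \<theta> where "\<theta> k = (\<alpha> k - \<gamma> / 2 + pi) rmod (2 * pi) - pi" for k
  have \<theta>_cong: "[\<theta> k = \<alpha> k - \<gamma> / 2] (rmod (2 * pi))" for k
    using rcong_diff[OF rcong_rmod_left[OF rcong_refl] rcong_refl,
        of "\<alpha> k - \<gamma> / 2 + pi" "2 * pi" pi]
    by (simp add: \<theta>_def)
  have double: "[2 * \<theta> k = 2 * \<alpha> k - \<gamma>] (rmod (2 * pi))" for k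
    using rcong_add[OF \<theta>_cong[of k] \<theta>_cong[of k]] by (simp add: algebra_simps)
  have C_sum: "(\<Sum>j\<in>UNIV. m j * cos (2 * (\<alpha> i - \<alpha> j))) = cos (2 * \<alpha> i) * C + sin (2 * \<alpha> i) * S" for i
    by (simp add: C_def S_def right_diff_distrib cos_diff sum_distrib_left algebra_simps sum.distrib)
  have S_sum: "(\<Sum>j\<in>UNIV. m j * sin (2 * (\<alpha> i - \<alpha> j))) = sin (2 * \<alpha> i) * C - cos (2 * \<alpha> i) * S" for i
    by (simp add: C_def S_def right_diff_distrib sin_diff sum_distrib_left algebra_simps sum_subtractf)
  have "translated_angles m (\<lambda>i j. \<alpha> i - \<alpha> j) s \<theta>"
    unfolding translated_angles_def A_def[symmetric] C_sum S_sum
  proof (intro conjI allI)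
    fix i j
    show "\<theta> i \<in> {-pi..pi}"
      using rmod_nonneg[of "2 * pi" "\<alpha> i - \<gamma> / 2 + pi"] rmod_le[of "2 * pi" "\<alpha> i - \<gamma> / 2 + pi"]
      by (simp add: \<theta>_def)
    show "[\<theta> i - \<theta> j = \<alpha> i - \<alpha> j] (rmod (2 * pi))"
      using rcong_diff[OF \<theta>_cong[of i] \<theta>_cong[of j]] by simp
    show "cos (2 * \<theta> i) = s / A * (cos (2 * \<alpha> i) * C + sin (2 * \<alpha> i) * S)"
      by (simp add: cos_rcong[OF double] cos_diff flip: \<gamma>) (simp add: algebra_simps add_divide_distrib)
    show "sin (2 * \<theta> i) = s / A * (sin (2 * \<alpha> i) * C - cos (2 * \<alpha> i) * S)"
      by (simp add: sin_rcong[OF double] sin_diff flip: \<gamma>) (simp add: algebra_simps diff_divide_distrib)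
  qed
  then show ?thesis by blast
qed

lemma shape_F_rcong:
  assumes "\<And>i j. [\<delta> i j = \<delta>' i j] (rmod (2 * pi))"
  shows "shape_F m U' \<delta> = shape_F m U' \<delta>'"
  using sin_rcong[OF assms] cos_rcong[OF assms] by (simp add: shape_F_def fun_eq_iff)

text \<open>Multiplied by \<open>m k\<close>, the sine part of the translation formula replaces
  \<open>m k * sin (2 * \<theta> k)\<close> by \<open>s / A\<close> times the sum of
  \<open>shape_G\<close> over row \<open>k\<close>. The forces see the differences only modulo
  \<open>2 * pi\<close>.\<close>

lemma translated_solution_iff:
  assumes U_deriv: "\<And>x. x \<in> {-1<..<1} \<Longrightarrow> (U has_real_derivative U' x) (at x)"
    and sin_nz: "\<And>i j. i \<noteq> j \<Longrightarrow> sin (\<alpha> i - \<alpha> j) \<noteq> 0"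
    and \<theta>: "translated_angles m (\<lambda>i j. \<alpha> i - \<alpha> j) s \<theta>"
  shows "three_body_solution m U (meridian_motion \<theta> \<omega> \<phi>\<^sub>0) \<longleftrightarrow>
    shape_equations m U' (\<lambda>i j. \<alpha> i - \<alpha> j) s \<omega>"
proof -
  let ?\<delta> = "\<lambda>i j. \<alpha> i - \<alpha> j"
  have cong: "[\<theta> i - \<theta> j = \<alpha> i - \<alpha> j] (rmod (2 * pi))" for i j
    using \<theta> by (simp add: translated_angles_def)
  have "\<omega>\<^sup>2 / 2 * (m k * sin (2 * \<theta> k)) =
      s * (\<omega>\<^sup>2 / (2 * shape_A m ?\<delta>)) * (\<Sum>j\<in>UNIV - {k}. shape_G m ?\<delta> k j)" for k
  proof -
    \<comment> \<open>The diagonal term contains \<open>sin 0\<close>.\<close>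
    have "(\<Sum>j\<in>UNIV - {k}. shape_G m ?\<delta> k j) = (\<Sum>j\<in>UNIV. shape_G m ?\<delta> k j)"
      by (simp add: sum.remove[of UNIV k] shape_G_def)
    also have "\<dots> = m k * (\<Sum>j\<in>UNIV. m j * sin (2 * ?\<delta> k j))"
      by (simp add: shape_G_def sum_distrib_left mult.assoc)
    finally show ?thesis
      using \<theta> by (simp add: translated_angles_def)
  qed
  then show ?thesis
    unfolding shape_equations_iff shape_F_rcong[OF cong, symmetric]
    using sin_nz by (subst meridian_motion_solution_iff[OF U_deriv]) (simp_all add: sin_rcong[OF cong] mult.commute)
qed

section \<open>Linear algebra of the determinant\<close>

text \<open>Excludes a zero first row of the matrix: otherwise the doubled angles would all point
  along the line of (C, S).\<close>

lemma shape_A_eq_0_if_G_equal: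
  assumes mass_nz: "\<And>k. m k \<noteq> 0"
    and sin_nz: "\<And>i j. i \<noteq> j \<Longrightarrow> sin (\<alpha> i - \<alpha> j) \<noteq> 0"
    and G: "shape_G m (\<lambda>i j. \<alpha> i - \<alpha> j) 1 2 = shape_G m (\<lambda>i j. \<alpha> i - \<alpha> j) 2 3"
      "shape_G m (\<lambda>i j. \<alpha> i - \<alpha> j) 3 1 = shape_G m (\<lambda>i j. \<alpha> i - \<alpha> j) 1 2"
  shows "shape_A m (\<lambda>i j. \<alpha> i - \<alpha> j) = 0"
proof (rule ccontr)
  define C S where "C = (\<Sum>j\<in>UNIV. m j * cos (2 * \<alpha> j))" and "S = (\<Sum>j\<in>UNIV. m j * sin (2 * \<alpha> j))"
  assume "shape_A m (\<lambda>i j. \<alpha> i - \<alpha> j) \<noteq> 0"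
  then have nz: "C \<noteq> 0 \<or> S \<noteq> 0"
    by (auto simp: shape_A_eq C_def S_def)
  \<comment> \<open>Each row sum is, by antisymmetry, a difference of two of the three equal cyclic
    values.\<close>
  have "\<forall>k. (\<Sum>j\<in>UNIV. shape_G m (\<lambda>i j. \<alpha> i - \<alpha> j) k j) = 0"
    using G shape_G_minus[of m \<alpha> 1 2] shape_G_minus[of m \<alpha> 2 3] shape_G_minus[of m \<alpha> 3 1]
    by (simp add: forall_3 sum_3) (simp add: shape_G_def)
  moreover have "(\<Sum>j\<in>UNIV. shape_G m (\<lambda>i j. \<alpha> i - \<alpha> j) k j) =
      m k * (sin (2 * \<alpha> k) * C - cos (2 * \<alpha> k) * S)" for k
    by (simp add: shape_G_def C_def S_def right_diff_distrib sin_diff sum_distrib_left sum_subtractf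
        algebra_simps)
  ultimately have parallel: "sin (2 * \<alpha> k) * C = cos (2 * \<alpha> k) * S" for k
    using mass_nz by simp
  have "sin (2 * \<alpha> i - 2 * \<alpha> j) = 0" for i j
  proof -
    have "sin (2 * \<alpha> i - 2 * \<alpha> j) * C = 0" "sin (2 * \<alpha> i - 2 * \<alpha> j) * S = 0"
      using parallel[of i] parallel[of j] unfolding sin_diff by algebra+
    then show ?thesis using nz by auto
  qed
  then have "cos (\<alpha> i - \<alpha> j) = 0" if "i \<noteq> j" for i j
    using sin_double[of "\<alpha> i - \<alpha> j"] sin_nz[OF that] by (simp add: right_diff_distrib)
  \<comment> \<open>Two odd multiples of \<open>pi / 2\<close> add up to a multiple of
    \<open>pi\<close>, against \<open>sin_nz\<close>.\<close>
  from this[of 1 2] this[of 2 3] have "sin (\<alpha> 1 - \<alpha> 3) = 0"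
    using sin_add[of "\<alpha> 1 - \<alpha> 2" "\<alpha> 2 - \<alpha> 3"] by simp
  then show False using sin_nz[of 1 3] by simp
qed

lemma det_2_eq_0_iff_proportional:
  fixes a b c d :: "'a::field"
  assumes "a \<noteq> 0 \<or> b \<noteq> 0"
  shows "det (vector [vector [a, b], vector [c, d]] :: 'a^2^2) = 0 \<longleftrightarrow> (\<exists>r. r * a = c \<and> r * b = d)"
proof -
  have "det (vector [vector [a, b], vector [c, d]] :: 'a^2^2) = a * d - b * c"
    by (simp add: det_2)
  moreover have "a * d - b * c = 0 \<longleftrightarrow> (\<exists>r. r * a = c \<and> r * b = d)"
  proof
    assume "a * d - b * c = 0"
    then have "a * d = b * c" by simp
    then show "\<exists>r. r * a = c \<and> r * b = d"
      using assms
      \<comment> \<open>The factor is read off from a column whose upper entry is nonzero.\<close>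
      by (intro exI[of _ "if a = 0 then d / b else c / a"]) (auto simp: field_simps)
  qed auto
  ultimately show ?thesis by simp
qed

text \<open>The sign of \<open>r\<close> goes into \<open>s\<close> and its size into \<omega>, so
  the factor in the shape equations can be any real number.\<close>

lemma ex_sign_square:
  fixes r A :: real
  assumes "A > 0"
  obtains s \<omega> where "s \<in> {1, -1}" "\<omega> \<ge> 0" "s * (\<omega>\<^sup>2 / (2 * A)) = r"
proof (rule that[of "if r \<ge> 0 then 1 else -1" "sqrt (2 * A * \<bar>r\<bar>)"])
qed (use assms in auto)

text \<open>The cyclic differences add up to zero on both sides, so the equation for (2, 3, 1)
  follows from the other two.\<close>

lemma shape_equations_proportional_iff:
  "shape_equations m U' \<delta> s \<omega> \<longleftrightarrow> (let r = s * (\<omega>\<^sup>2 / (2 * shape_A m \<delta>)) in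
     r * (shape_G m \<delta> 1 2 - shape_G m \<delta> 2 3) = shape_F m U' \<delta> 1 2 - shape_F m U' \<delta> 2 3 \<and>
     r * (shape_G m \<delta> 3 1 - shape_G m \<delta> 1 2) = shape_F m U' \<delta> 3 1 - shape_F m U' \<delta> 1 2)"
proof -
  define r where "r = s * (\<omega>\<^sup>2 / (2 * shape_A m \<delta>))"
  show ?thesis
    unfolding shape_equations_def r_def[symmetric] Let_def by (auto simp: algebra_simps)
qed

theorem theorem3:
  fixes m :: "3 \<Rightarrow> real" and U U' :: "real \<Rightarrow> real"
    and \<alpha> :: "3 \<Rightarrow> real" and \<delta> :: "3 \<Rightarrow> 3 \<Rightarrow> real"
  assumes mass_pos: "\<And>k. m k > 0"
    and U_deriv: "\<And>x. x \<in> {-1<..<1} \<Longrightarrow> (U has_real_derivative U' x) (at x)"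
    and U'_cont: "continuous_on {-1<..<1} U'"
    and U'_sign: "(\<forall>x\<in>{-1<..<1}. U' x > 0) \<or> (\<forall>x\<in>{-1<..<1}. U' x < 0)"
    and shape: "\<And>i j. \<delta> i j = \<alpha> i - \<alpha> j"
    and nonsingular: "\<And>i j. i \<noteq> j \<Longrightarrow> \<not> (\<exists>n::int. \<delta> i j = of_int n * pi)"
    and A_nonzero: "shape_A m \<delta> \<noteq> 0"
  shows "(det (vector [vector [shape_G m \<delta> 1 2 - shape_G m \<delta> 2 3,
                               shape_G m \<delta> 3 1 - shape_G m \<delta> 1 2],
                       vector [shape_F m U' \<delta> 1 2 - shape_F m U' \<delta> 2 3,
                               shape_F m U' \<delta> 3 1 - shape_F m U' \<delta> 1 2]]
               :: real^2^2) = 0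
          \<longleftrightarrow> (\<exists>s\<in>{1, -1}. \<exists>\<omega>\<ge>0. shape_equations m U' \<delta> s \<omega>))
       \<and> (\<forall>s\<in>{1, -1}. \<forall>\<omega>\<ge>0.
            shape_equations m U' \<delta> s \<omega> \<longleftrightarrow> generates_euler_equilibrium m U \<delta> s \<omega>)"
proof
  have \<delta>: "\<delta> = (\<lambda>i j. \<alpha> i - \<alpha> j)"
    by (simp add: fun_eq_iff shape)
  have sin_nz: "sin (\<alpha> i - \<alpha> j) \<noteq> 0" if "i \<noteq> j" for i j
    using nonsingular[OF that] by (simp add: \<delta> sin_zero_iff_int2)
  have "shape_A m \<delta> \<ge> 0"
    unfolding \<delta> shape_A_eq by simp
  with A_nonzero have A_pos: "shape_A m \<delta> > 0" by simp
  have "shape_G m \<delta> 1 2 - shape_G m \<delta> 2 3 \<noteq> 0 \<or> shape_G m \<delta> 3 1 - shape_G m \<delta> 1 2 \<noteq> 0"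
    using shape_A_eq_0_if_G_equal[of m \<alpha>, OF less_imp_neq[OF mass_pos, symmetric] sin_nz] A_nonzero
    unfolding \<delta> right_minus_eq by blast
  then have "det (vector [vector [shape_G m \<delta> 1 2 - shape_G m \<delta> 2 3,
                               shape_G m \<delta> 3 1 - shape_G m \<delta> 1 2],
                       vector [shape_F m U' \<delta> 1 2 - shape_F m U' \<delta> 2 3,
                               shape_F m U' \<delta> 3 1 - shape_F m U' \<delta> 1 2]]
               :: real^2^2) = 0
      \<longleftrightarrow> (\<exists>r.
        r * (shape_G m \<delta> 1 2 - shape_G m \<delta> 2 3) = shape_F m U' \<delta> 1 2 - shape_F m U' \<delta> 2 3 \<and>
        r * (shape_G m \<delta> 3 1 - shape_G m \<delta> 1 2) = shape_F m U' \<delta> 3 1 - shape_F m U' \<delta> 1 2)"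
    by (rule det_2_eq_0_iff_proportional)
  also have "\<dots> \<longleftrightarrow> (\<exists>s\<in>{1, -1}. \<exists>\<omega>\<ge>0. shape_equations m U' \<delta> s \<omega>)"
    (is "(\<exists>r. ?P r) \<longleftrightarrow> _")
  proof
    assume "\<exists>r. ?P r"
    then obtain r where "?P r" ..
    moreover obtain s \<omega> where "s \<in> {1, -1}" "\<omega> \<ge> 0" "s * (\<omega>\<^sup>2 / (2 * shape_A m \<delta>)) = r"
      by (rule ex_sign_square[OF A_pos])
    ultimately show "\<exists>s\<in>{1, -1}. \<exists>\<omega>\<ge>0. shape_equations m U' \<delta> s \<omega>"
      unfolding shape_equations_proportional_iff Let_def by blast
  next
    assume "\<exists>s\<in>{1, -1}. \<exists>\<omega>\<ge>0. shape_equations m U' \<delta> s \<omega>"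
    then show "\<exists>r. ?P r"
      unfolding shape_equations_proportional_iff Let_def by blast
  qed
  finally show "det (vector [vector [shape_G m \<delta> 1 2 - shape_G m \<delta> 2 3,
                               shape_G m \<delta> 3 1 - shape_G m \<delta> 1 2],
                       vector [shape_F m U' \<delta> 1 2 - shape_F m U' \<delta> 2 3,
                               shape_F m U' \<delta> 3 1 - shape_F m U' \<delta> 1 2]]
               :: real^2^2) = 0
          \<longleftrightarrow> (\<exists>s\<in>{1, -1}. \<exists>\<omega>\<ge>0. shape_equations m U' \<delta> s \<omega>)" .
  show "\<forall>s\<in>{1, -1}. \<forall>\<omega>\<ge>0.
      shape_equations m U' \<delta> s \<omega> \<longleftrightarrow> generates_euler_equilibrium m U \<delta> s \<omega>"
  proof (intro ballI allI impI)
    fix s \<omega> :: real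
    assume "s \<in> {1, -1}"
    then have ex: "\<exists>\<theta>. translated_angles m \<delta> s \<theta>"
      unfolding \<delta> by (rule ex_translated_angles[OF A_nonzero[unfolded \<delta>]])
    have eq: "euler_equilibrium_on_rotating_meridian m U \<theta> \<omega> (meridian_motion \<theta> \<omega> \<phi>\<^sub>0) \<and>
        (\<omega> = 0 \<longrightarrow> fixed_point m U (meridian_motion \<theta> \<omega> \<phi>\<^sub>0)) \<longleftrightarrow> shape_equations m U' \<delta> s \<omega>"
      if \<theta>: "translated_angles m \<delta> s \<theta>" for \<theta> \<phi>\<^sub>0
    proof -
      have "three_body_solution m U (meridian_motion \<theta> \<omega> \<phi>\<^sub>0) \<longleftrightarrow> shape_equations m U' \<delta> s \<omega>"
        unfolding \<delta> by (rule translated_solution_iff[OF U_deriv sin_nz \<theta>[unfolded \<delta>]])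
      moreover have "\<theta> k \<in> {-pi..pi}" for k
        using \<theta> by (simp add: translated_angles_def)
      ultimately show ?thesis
        using fixed_point_meridian_motion[of m U \<theta> \<phi>\<^sub>0]
        by (auto simp: euler_equilibrium_meridian_motion_iff)
    qed
    have "generates_euler_equilibrium m U \<delta> s \<omega> \<longleftrightarrow>
        (\<forall>\<theta> \<phi>\<^sub>0. translated_angles m \<delta> s \<theta> \<longrightarrow>
          euler_equilibrium_on_rotating_meridian m U \<theta> \<omega> (meridian_motion \<theta> \<omega> \<phi>\<^sub>0) \<and>
          (\<omega> = 0 \<longrightarrow> fixed_point m U (meridian_motion \<theta> \<omega> \<phi>\<^sub>0)))"
      using ex by (simp only: generates_euler_equilibrium_def simp_thms)
    \<comment> \<open>The conclusion no longer depends on the angles or the phase; \<open>ex\<close>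
      then lets the quantifiers be dropped, as the premise is satisfiable.\<close>
    also have "\<dots> \<longleftrightarrow>
        (\<forall>\<theta> (\<phi>\<^sub>0::real). translated_angles m \<delta> s \<theta> \<longrightarrow> shape_equations m U' \<delta> s \<omega>)"
      by (intro iff_allI imp_cong refl eq)
    finally show "shape_equations m U' \<delta> s \<omega> \<longleftrightarrow> generates_euler_equilibrium m U \<delta> s \<omega>"
      using ex by blast
  qed
qed

end
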